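(* Let $f:\mathbb{R}^{n\times p}\to\mathbb{R}$ be locally Lipschitz continuous, let $\beta>0$, and let $g=f\circ\mathcal{A}$. For any $X\in\mathbb{R}^{n\times p}$, it holds that $$\partial g(X)=\mathcal{J}_{\mathcal A}(X)[\partial f(\mathcal{A}(X))]$$ and $$\partial h(X)=\mathcal{J}_{\mathcal A}(X)[\partial f(\mathcal{A}(X))]+\beta X(X^\top X-I_p).$$
   Context: $\partial$ denotes the Clarke subdifferential of a locally Lipschitz function, with respect to the inner product $\langle X,Y\rangle=\mathrm{tr}(X^\top Y)$ on $\mathbb{R}^{n\times p}$. $\mathcal{A}:\mathbb{R}^{n\times p}\to\mathbb{R}^{n\times p}$ is $\mathcal{A}(X)=\frac18X\left(15I_p-10X^\top X+3(X^\top X)^2\right)$. $\mathcal{J}_{\mathcal A}(X)$ is the derivative of $\mathcal{A}$ at $X$, viewed as a linear map $\mathbb{R}^{n\times p}\to\mathbb{R}^{n\times p}$: $\mathcal{J}_{\mathcal A}(X)[D]=\lim_{t\to0}\frac1t(\mathcal{A}(X+tD)-\mathcal{A}(X))$; for a set $\mathcal F\subseteq\mathbb{R}^{n\times p}$, $\mathcal{J}_{\mathcal A}(X)[\mathcal F]=\{\mathcal{J}_{\mathcal A}(X)[D]:D\in\mathcal F\}$. $h(X)=f(\mathcal{A}(X))+\frac{\beta}{4}\|X^\top X-I_p\|_{\mathrm F}^2$. *)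

theory Defs
  imports "HOL-Analysis.Analysis"
begin

definition locally_lipschitz :: "('a::metric_space \<Rightarrow> 'b::metric_space) \<Rightarrow> bool"
  where "locally_lipschitz f \<longleftrightarrow> (\<forall>x. \<exists>u>0. \<exists>L. L-lipschitz_on (cball x u) f)"

text \<open>
  Clarke's generalized directional derivative: the upper limit of the difference quotient
  \<open>(f (y + t d) - f y) / t\<close> as \<open>y\<close> tends to \<open>x\<close> (with \<open>y = x\<close> allowed) and \<open>t\<close> decreases to 0.
  It is taken in the extended reals, so it needs no finiteness assumption; for locally Lipschitz
  \<open>f\<close> it is finite.
\<close>

definition clarke_dderiv :: "('a::real_normed_vector \<Rightarrow> real) \<Rightarrow> 'a \<Rightarrow> 'a \<Rightarrow> ereal"
  where "clarke_dderiv f x d =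
    Limsup (nhds x \<times>\<^sub>F at_right 0) (\<lambda>(y, t). ereal ((f (y + t *\<^sub>R d) - f y) / t))"

definition clarke_subdiff :: "('a::real_inner \<Rightarrow> real) \<Rightarrow> 'a \<Rightarrow> 'a set"
  where "clarke_subdiff f x = {v. \<forall>d. ereal (v \<bullet> d) \<le> clarke_dderiv f x d}"

text \<open>
  An \<open>n \<times> p\<close> matrix has type \<open>real ^ 'p ^ 'n\<close>. The inner product of this type is the trace
  inner product, so its norm is the Frobenius norm.
\<close>

lemma inner_eq_trace:
  fixes X Y :: "real ^ 'p ^ 'n"
  shows "X \<bullet> Y = trace (transpose X ** Y)"
  unfolding inner_vec_def trace_def matrix_matrix_mult_def transpose_def
  by (simp, rule sum.swap)

definition cdA :: "real ^ 'p ^ 'n \<Rightarrow> real ^ 'p ^ 'n"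
  where "cdA X = (1 / 8) *\<^sub>R (X ** (15 *\<^sub>R mat 1 - 10 *\<^sub>R (transpose X ** X)
    + 3 *\<^sub>R ((transpose X ** X) ** (transpose X ** X))))"

definition jacA :: "real ^ 'p ^ 'n \<Rightarrow> real ^ 'p ^ 'n \<Rightarrow> real ^ 'p ^ 'n"
  where "jacA X D = Lim (at 0) (\<lambda>t::real. (1 / t) *\<^sub>R (cdA (X + t *\<^sub>R D) - cdA X))"

definition cdh :: "(real ^ 'p ^ 'n \<Rightarrow> real) \<Rightarrow> real \<Rightarrow> real ^ 'p ^ 'n \<Rightarrow> real"
  where "cdh f \<beta> X = f (cdA X) + \<beta> / 4 * (norm (transpose X ** X - mat 1))\<^sup>2"

text \<open>The limit defining \<open>jacA\<close> exists, and \<open>jacA X\<close> is the Frechet derivative of \<open>cdA\<close> at \<open>X\<close>.\<close>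

lemma bounded_bilinear_matrix_mult:
  "bounded_bilinear ((**) :: real ^ 'm ^ 'n \<Rightarrow> real ^ 'p ^ 'm \<Rightarrow> real ^ 'p ^ 'n)"
  unfolding bilinear_conv_bounded_bilinear [symmetric] bilinear_def
  by (auto intro!: linearI simp: vec_eq_iff matrix_matrix_mult_def
      sum.distrib algebra_simps sum_distrib_left)

lemma bounded_linear_transpose:
  "bounded_linear (transpose :: real ^ 'p ^ 'n \<Rightarrow> real ^ 'n ^ 'p)"
  unfolding linear_conv_bounded_linear [symmetric]
  by (auto intro!: linearI simp: transpose_def vec_eq_iff)

lemma cdA_differentiable:
  fixes X :: "real ^ 'p ^ 'n"
  shows "cdA differentiable (at X)"
proof -
  have mult: "(\<lambda>X. F X ** G X) differentiable (at X)"
    if diff: "F differentiable (at X)" "G differentiable (at X)"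
    for F :: "real ^ 'p ^ 'n \<Rightarrow> real ^ 'b ^ 'a" and G :: "real ^ 'p ^ 'n \<Rightarrow> real ^ 'c ^ 'b"
  proof -
    obtain F' G' where "(F has_derivative F') (at X)" "(G has_derivative G') (at X)"
      using diff unfolding differentiable_def by blast
    from bounded_bilinear.FDERIV [OF bounded_bilinear_matrix_mult this] show ?thesis
      by (rule differentiableI)
  qed
  have T: "transpose differentiable (at X)"
    by (rule bounded_linear_imp_differentiable [OF bounded_linear_transpose])
  have M: "(\<lambda>X. transpose X ** X) differentiable (at X)"
    by (rule mult [OF T differentiable_ident])
  have scale: "(\<lambda>X. c *\<^sub>R F X) differentiable (at X)"
    if "F differentiable (at X)" for c :: real and F :: "real ^ 'p ^ 'n \<Rightarrow> real ^ 'b ^ 'a"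
    by (rule differentiable_scaleR [OF differentiable_const that])
  show ?thesis
    unfolding cdA_def [abs_def]
    by (rule scale mult [OF differentiable_ident] differentiable_add differentiable_diff
        differentiable_const M mult [OF M M])+
qed

lemma has_derivative_cdA: "(cdA has_derivative jacA X) (at X)"
proof -
  obtain A' where A': "(cdA has_derivative A') (at X)"
    using cdA_differentiable [of X] by (auto simp: differentiable_def)
  have "jacA X D = A' D" for D
  proof -
    have "(cdA has_derivative A') (at (X + 0 *\<^sub>R D))"
      using A' by simp
    moreover have "((\<lambda>t::real. X + t *\<^sub>R D) has_derivative (\<lambda>t. t *\<^sub>R D)) (at 0)"
      by (auto intro!: derivative_eq_intros)
    ultimately have "((\<lambda>t::real. cdA (X + t *\<^sub>R D)) has_derivative (\<lambda>t. A' (t *\<^sub>R D))) (at 0)"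
      using has_derivative_compose by blast
    then have "((\<lambda>t::real. cdA (X + t *\<^sub>R D)) has_vector_derivative A' D) (at 0)"
      unfolding has_vector_derivative_def
      by (simp add: linear_cmul [OF has_derivative_linear [OF A']])
    then have "((\<lambda>t. norm (cdA (X + t *\<^sub>R D) - cdA X - t *\<^sub>R A' D) / norm t) \<longlongrightarrow> 0) (at 0)"
      unfolding has_vector_derivative_def has_derivative_at by simp
    moreover have "\<forall>\<^sub>F t in at 0. norm (cdA (X + t *\<^sub>R D) - cdA X - t *\<^sub>R A' D) / norm t =
        norm ((1 / t) *\<^sub>R (cdA (X + t *\<^sub>R D) - cdA X) - A' D)"
    proof (rule eventually_at_topological [THEN iffD2], intro exI [of _ UNIV] conjI ballI impI)
      fix t :: real assume "t \<noteq> 0"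
      then have "(1 / t) *\<^sub>R (cdA (X + t *\<^sub>R D) - cdA X) - A' D =
          (1 / t) *\<^sub>R (cdA (X + t *\<^sub>R D) - cdA X - t *\<^sub>R A' D)"
        by (simp add: scaleR_right_diff_distrib)
      then show "norm (cdA (X + t *\<^sub>R D) - cdA X - t *\<^sub>R A' D) / norm t =
          norm ((1 / t) *\<^sub>R (cdA (X + t *\<^sub>R D) - cdA X) - A' D)"
        by simp
    qed auto
    ultimately have "((\<lambda>t. norm ((1 / t) *\<^sub>R (cdA (X + t *\<^sub>R D) - cdA X) - A' D)) \<longlongrightarrow> 0) (at 0)"
      by (rule Lim_transform_eventually)
    then have "((\<lambda>t::real. (1 / t) *\<^sub>R (cdA (X + t *\<^sub>R D) - cdA X)) \<longlongrightarrow> A' D) (at 0)"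
      by (rule tendsto_norm_zero_cancel [THEN LIM_zero_cancel])
    then show ?thesis
      unfolding jacA_def by (intro tendsto_Lim) auto
  qed
  then have "jacA X = A'" by blast
  then show ?thesis using A' by simp
qed

end

theory Submission
  imports Defs
begin

text \<open>
  The Jacobian of \<open>cdA\<close> degenerates at orthonormal matrices, so the chain rule does not follow
  from a local inverse. But \<open>cdA\<close> applies the strictly increasing function
  \<open>s (15 - 10 s\<^sup>2 + 3 s\<^sup>4) / 8\<close> to the singular values; it is therefore injective, and open by
  invariance of domain. Since it is also continuously differentiable, the Clarke directional
  derivative of \<open>f \<circ> cdA\<close> at \<open>X\<close> in direction \<open>D\<close> equals that of \<open>f\<close> at \<open>cdA X\<close> in direction
  \<open>jacA X D\<close>. By Hahn--Banach the subdifferential of \<open>f \<circ> cdA\<close> is then the image of that of \<open>f\<close>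
  under the adjoint of \<open>jacA X\<close>, and \<open>jacA X\<close> is self-adjoint because \<open>cdA\<close> is a gradient. The
  penalty term is continuously differentiable and only translates the subdifferential.
\<close>

section \<open>Upper limits\<close>

text \<open>Eventually \<open>v\<close> stays below \<open>c + e\<close>, which gives one
  inequality; the other is the same inequality for \<open>u + v\<close> and
  \<open>- v\<close>.\<close>

lemma Limsup_ereal_add_tendsto:
  fixes u v :: "'a \<Rightarrow> real"
  assumes F: "F \<noteq> bot" and v: "(v \<longlongrightarrow> c) F"
  shows "Limsup F (\<lambda>x. ereal (u x + v x)) = Limsup F (\<lambda>x. ereal (u x)) + ereal c"
proof -
  have le: "Limsup F (\<lambda>x. ereal (u x + v x)) \<le> Limsup F (\<lambda>x. ereal (u x)) + ereal c"
    if v: "(v \<longlongrightarrow> c) F" for u v :: "'a \<Rightarrow> real" and c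
  proof (rule ereal_le_epsilon2)
    fix e :: real assume "e > 0"
    then have "\<forall>\<^sub>F x in F. v x < c + e"
      using order_tendstoD(2) [OF v, of "c + e"] by simp
    then have "Limsup F (\<lambda>x. ereal (u x + v x)) \<le> Limsup F (\<lambda>x. ereal (u x) + ereal (c + e))"
      by (intro Limsup_mono) (auto elim!: eventually_mono)
    also have "\<dots> = Limsup F (\<lambda>x. ereal (u x)) + ereal (c + e)"
      by (rule Limsup_add_ereal_right [OF F]) simp
    finally show "Limsup F (\<lambda>x. ereal (u x + v x)) \<le> Limsup F (\<lambda>x. ereal (u x)) + ereal c + ereal e"
      by (simp add: add.assoc)
  qed
  have "Limsup F (\<lambda>x. ereal (u x)) = Limsup F (\<lambda>x. ereal ((u x + v x) + (- v x)))"
    by simp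
  also have "\<dots> \<le> Limsup F (\<lambda>x. ereal (u x + v x)) + ereal (- c)"
    by (intro le tendsto_minus v)
  finally have "Limsup F (\<lambda>x. ereal (u x)) + ereal c \<le> Limsup F (\<lambda>x. ereal (u x + v x))"
    by (cases "Limsup F (\<lambda>x. ereal (u x))"; cases "Limsup F (\<lambda>x. ereal (u x + v x))") auto
  with le [OF v, of u] show ?thesis by (intro antisym)
qed

section \<open>Clarke directional derivatives\<close>

abbreviation clarke_filter :: "'a::real_normed_vector \<Rightarrow> ('a \<times> real) filter"
  where "clarke_filter x \<equiv> nhds x \<times>\<^sub>F at_right 0"

lemma clarke_filter_nontrivial [simp]: "clarke_filter x \<noteq> bot"
  by (simp add: prod_filter_eq_bot)

lemma tendsto_fst_clarke: "((\<lambda>p. fst p) \<longlongrightarrow> x) (clarke_filter x)"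
  by (rule filterlim_fst)

lemma filterlim_snd_clarke: "filterlim (\<lambda>p. snd p) (at_right 0) (clarke_filter x)"
  by (rule filterlim_snd)

lemma tendsto_snd_clarke: "((\<lambda>p. snd p) \<longlongrightarrow> 0) (clarke_filter x)"
  using filterlim_snd_clarke [of x] by (simp add: filterlim_at)

lemma eventually_snd_pos_clarke: "\<forall>\<^sub>F p in clarke_filter x. snd p > 0"
  using filterlim_snd_clarke [of x] by (auto simp: filterlim_at elim: eventually_mono)

lemma tendsto_shift_clarke: "((\<lambda>p. fst p + snd p *\<^sub>R d) \<longlongrightarrow> x) (clarke_filter x)"
  using tendsto_add [OF tendsto_fst_clarke tendsto_scaleR [OF tendsto_snd_clarke tendsto_const]]
  by simp

lemma clarke_dderiv_alt:
  "clarke_dderiv f x d =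
    Limsup (clarke_filter x) (\<lambda>p. ereal ((f (fst p + snd p *\<^sub>R d) - f (fst p)) / snd p))"
  by (simp add: clarke_dderiv_def case_prod_unfold)

lemma clarke_dderiv_lessD:
  assumes "clarke_dderiv f x d < ereal r"
  shows "\<forall>\<^sub>F p in clarke_filter x. (f (fst p + snd p *\<^sub>R d) - f (fst p)) / snd p < r"
  using Limsup_lessD [OF assms [unfolded clarke_dderiv_alt]] by simp

lemma clarke_dderiv_leI:
  assumes "\<forall>\<^sub>F p in clarke_filter x. (f (fst p + snd p *\<^sub>R d) - f (fst p)) / snd p \<le> r"
  shows "clarke_dderiv f x d \<le> ereal r"
  unfolding clarke_dderiv_alt by (rule Limsup_bounded) (use assms in simp)

lemma clarke_dderiv_geI:
  assumes "\<forall>\<^sub>F p in clarke_filter x. r \<le> (f (fst p + snd p *\<^sub>R d) - f (fst p)) / snd p"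
  shows "ereal r \<le> clarke_dderiv f x d"
proof -
  have "Limsup (clarke_filter x) (\<lambda>p. ereal r) \<le> clarke_dderiv f x d"
    unfolding clarke_dderiv_alt by (rule Limsup_mono) (use assms in simp)
  then show ?thesis by (simp add: Limsup_const)
qed

section \<open>Finiteness and sublinearity of the directional derivative\<close>

lemma eventually_lipschitz_bound:
  fixes f :: "'a::metric_space \<Rightarrow> real"
  assumes "locally_lipschitz f" and a: "(a \<longlongrightarrow> x) F" and b: "(b \<longlongrightarrow> x) F"
  shows "\<exists>L. \<forall>\<^sub>F p in F. \<bar>f (a p) - f (b p)\<bar> \<le> L * dist (a p) (b p)"
proof -
  obtain u L where u: "u > 0" and L: "L-lipschitz_on (cball x u) f"
    using assms(1) unfolding locally_lipschitz_def by blast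
  have "\<forall>\<^sub>F p in F. \<bar>f (a p) - f (b p)\<bar> \<le> L * dist (a p) (b p)"
    using tendstoD [OF a u] tendstoD [OF b u]
  proof eventually_elim
    case (elim p)
    then show ?case
      using lipschitz_onD [OF L, of "a p" "b p"] by (simp add: dist_commute dist_real_def)
  qed
  then show ?thesis ..
qed

lemma clarke_dderiv_finite:
  assumes "locally_lipschitz f"
  shows "\<bar>clarke_dderiv f x d\<bar> \<noteq> \<infinity>"
proof -
  obtain L where L: "\<forall>\<^sub>F p in clarke_filter x. \<bar>f (fst p + snd p *\<^sub>R d) - f (fst p)\<bar>
      \<le> L * dist (fst p + snd p *\<^sub>R d) (fst p)"
    using eventually_lipschitz_bound [OF assms tendsto_shift_clarke tendsto_fst_clarke] by blast
  have "\<forall>\<^sub>F p in clarke_filter x. \<bar>(f (fst p + snd p *\<^sub>R d) - f (fst p)) / snd p\<bar> \<le> L * norm d"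
    using L eventually_snd_pos_clarke
    by eventually_elim (simp add: dist_norm field_simps)
  then have "clarke_dderiv f x d \<le> ereal (L * norm d)" "ereal (- (L * norm d)) \<le> clarke_dderiv f x d"
    by (auto intro!: clarke_dderiv_leI clarke_dderiv_geI elim!: eventually_mono
        simp del: abs_divide simp: abs_le_iff)
  then show ?thesis
    by (cases "clarke_dderiv f x d") auto
qed

text \<open>The quotient is split at \<open>fst p + snd p *\<^sub>R e\<close>. This point also tends
  to \<open>x\<close>, and as base points vary in the filter, it may serve as one.\<close>

lemma clarke_dderiv_add_le:
  assumes d: "clarke_dderiv f x d < ereal a" and e: "clarke_dderiv f x e < ereal b"
  shows "clarke_dderiv f x (d + e) \<le> ereal (a + b)"
proof (rule clarke_dderiv_leI)
  have "filterlim (\<lambda>p. (fst p + snd p *\<^sub>R e, snd p)) (clarke_filter x) (clarke_filter x)"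
    by (intro filterlim_Pair tendsto_shift_clarke filterlim_snd_clarke)
  from eventually_compose_filterlim [OF clarke_dderiv_lessD [OF d] this]
  have "\<forall>\<^sub>F p in clarke_filter x.
      (f (fst p + snd p *\<^sub>R e + snd p *\<^sub>R d) - f (fst p + snd p *\<^sub>R e)) / snd p < a"
    by simp
  then show "\<forall>\<^sub>F p in clarke_filter x. (f (fst p + snd p *\<^sub>R (d + e)) - f (fst p)) / snd p \<le> a + b"
    using clarke_dderiv_lessD [OF e] eventually_snd_pos_clarke
  proof eventually_elim
    case (elim p)
    then show ?case
      by (simp add: scaleR_add_right ac_simps field_simps)
  qed
qed

lemma clarke_dderiv_scaleR_le:
  assumes d: "clarke_dderiv f x d < ereal a" and c: "c > 0"
  shows "clarke_dderiv f x (c *\<^sub>R d) \<le> ereal (c * a)"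
proof (rule clarke_dderiv_leI)
  have "filterlim (\<lambda>p. c * snd p) (at_right 0) (clarke_filter x)"
    unfolding filterlim_at
    using tendsto_mult_right_zero [OF tendsto_snd_clarke] c
    by (auto intro!: eventually_mono [OF eventually_snd_pos_clarke])
  then have "filterlim (\<lambda>p. (fst p, c * snd p)) (clarke_filter x) (clarke_filter x)"
    by (intro filterlim_Pair tendsto_fst_clarke)
  from eventually_compose_filterlim [OF clarke_dderiv_lessD [OF d] this]
  have "\<forall>\<^sub>F p in clarke_filter x. (f (fst p + (c * snd p) *\<^sub>R d) - f (fst p)) / (c * snd p) < a"
    by simp
  then show "\<forall>\<^sub>F p in clarke_filter x. (f (fst p + snd p *\<^sub>R (c *\<^sub>R d)) - f (fst p)) / snd p \<le> c * a"
    using eventually_snd_pos_clarke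
  proof eventually_elim
    case (elim p)
    then show ?case using c
      by (simp add: field_simps)
  qed
qed

text \<open>Subadditivity and positive homogeneity give convexity, which is what the separation
  argument needs.\<close>

lemma convex_on_clarke_dderiv:
  assumes "locally_lipschitz f"
  shows "convex_on UNIV (\<lambda>d. real_of_ereal (clarke_dderiv f x d))"
proof (rule convex_onI)
  fix t :: real and d e :: 'a
  assume t: "0 < t" "t < 1"
  define p where "p d = real_of_ereal (clarke_dderiv f x d)" for d
  have p: "clarke_dderiv f x d = ereal (p d)" for d
    using clarke_dderiv_finite [OF assms, of x d] by (simp add: p_def ereal_real)
  have scale: "p (c *\<^sub>R d) \<le> c * p d" if "c > 0" for c d
  proof (rule field_le_epsilon)
    fix r :: real assume "r > 0"
    with that show "p (c *\<^sub>R d) \<le> c * p d + r"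
      using clarke_dderiv_scaleR_le [of f x d "p d + r / c" c] by (simp add: p distrib_left)
  qed
  have add: "p (d + e) \<le> p d + p e" for d e
  proof (rule field_le_epsilon)
    fix r :: real assume "r > 0"
    then show "p (d + e) \<le> p d + p e + r"
      using clarke_dderiv_add_le [of f x d "p d + r / 2" e "p e + r / 2"] by (simp add: p field_simps)
  qed
  have "p ((1 - t) *\<^sub>R d + t *\<^sub>R e) \<le> (1 - t) * p d + t * p e"
    using add [of "(1 - t) *\<^sub>R d" "t *\<^sub>R e"] scale [of "1 - t" d] scale [of t e] t by simp
  then show "real_of_ereal (clarke_dderiv f x ((1 - t) *\<^sub>R d + t *\<^sub>R e))
      \<le> (1 - t) * real_of_ereal (clarke_dderiv f x d) + t * real_of_ereal (clarke_dderiv f x e)"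
    by (simp add: p_def)
qed simp

section \<open>The chain rule\<close>

text \<open>The Hahn--Banach theorem, in the form that pulls a functional dominated by \<open>p \<circ> J\<close> back
  along \<open>J\<close>: separate the epigraph of \<open>p\<close> from the points strictly below the graph of \<open>v\<close> over
  the range of \<open>J\<close>.\<close>

lemma convex_dominated_factorization:
  fixes p :: "'a::euclidean_space \<Rightarrow> real" and J :: "'b::euclidean_space \<Rightarrow> 'a"
  assumes p: "convex_on UNIV p" and J: "linear J" and dom: "\<And>d. v \<bullet> d \<le> p (J d)"
  obtains w where "\<And>e. w \<bullet> e \<le> p e" and "\<And>d. w \<bullet> J d = v \<bullet> d"
proof -
  define T where "T = (\<lambda>(d, s). (J d, v \<bullet> d - s)) ` (UNIV \<times> {0::real<..})"
  interpret J: linear J by fact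
  have "linear (\<lambda>(d, s). (J d, v \<bullet> d - s))"
    by (rule linearI) (auto simp: J.add J.scale inner_add_right algebra_simps)
  then have "convex T"
    unfolding T_def by (intro convex_linear_image convex_Times) auto
  moreover have "convex (epigraph UNIV p)"
    using p by (simp add: convex_epigraph)
  moreover have "T \<inter> epigraph UNIV p = {}"
  proof -
    have "\<not> p (J d) \<le> v \<bullet> d - s" if "s > 0" for d s
      using dom [of d] that by linarith
    then show ?thesis by (auto simp: T_def epigraph_def)
  qed
  moreover have "T \<noteq> {}"
    by (auto simp: T_def intro: gt_ex)
  moreover have "(0, p 0) \<in> epigraph UNIV p"
    by (simp add: epigraph_def)
  ultimately obtain z b where z: "z \<noteq> 0" and T: "\<And>y. y \<in> T \<Longrightarrow> z \<bullet> y \<le> b"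
    and E: "\<And>y. y \<in> epigraph UNIV p \<Longrightarrow> z \<bullet> y \<ge> b"
    using separating_hyperplane_sets [of T "epigraph UNIV p"] by blast
  obtain a \<alpha> where z_eq: "z = (a, \<alpha>)" by (cases z)
  have below: "a \<bullet> J d + \<alpha> * (v \<bullet> d - s) \<le> b" if "s > 0" for d s
    using T [of "(J d, v \<bullet> d - s)"] that by (force simp: T_def z_eq)
  have above: "a \<bullet> e + \<alpha> * r \<ge> b" if "p e \<le> r" for e r
    using E [of "(e, r)"] that by (simp add: epigraph_def z_eq)
  \<comment> \<open>Points of \<open>T\<close> lie strictly below the graph; letting the gap
    \<open>s\<close> shrink to 0 extends the bound to the graph itself.\<close>
  have le: "a \<bullet> J d + \<alpha> * (v \<bullet> d) \<le> b" for d
  proof (rule tendsto_upperbound)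
    show "((\<lambda>s. a \<bullet> J d + \<alpha> * (v \<bullet> d - s)) \<longlongrightarrow> a \<bullet> J d + \<alpha> * (v \<bullet> d)) (at_right 0)"
      by (auto intro!: tendsto_eq_intros)
    show "\<forall>\<^sub>F s in at_right 0. a \<bullet> J d + \<alpha> * (v \<bullet> d - s) \<le> b"
      using below by (auto simp: eventually_at_right_field intro: exI [of _ 1])
  qed simp
  have b: "b \<ge> 0" using le [of 0] by simp
  \<comment> \<open>A linear functional bounded above cannot be positive anywhere: \<open>k\<close>
    is chosen so that its value at \<open>k *\<^sub>R d\<close> is \<open>b + 1\<close>.\<close>
  have le0: "a \<bullet> J d + \<alpha> * (v \<bullet> d) \<le> 0" for d
  proof (rule ccontr)
    assume "\<not> ?thesis"
    then have pos: "a \<bullet> J d + \<alpha> * (v \<bullet> d) > 0" by simp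
    define k where "k = (b + 1) / (a \<bullet> J d + \<alpha> * (v \<bullet> d))"
    have "a \<bullet> J (k *\<^sub>R d) + \<alpha> * (v \<bullet> (k *\<^sub>R d)) = k * (a \<bullet> J d + \<alpha> * (v \<bullet> d))"
      by (simp add: J.scale algebra_simps)
    also have "\<dots> = b + 1" using pos by (simp add: k_def)
    finally show False using le [of "k *\<^sub>R d"] by simp
  qed
  have eq0: "a \<bullet> J d + \<alpha> * (v \<bullet> d) = 0" for d
    using le0 [of d] le0 [of "- d"] by (simp add: J.neg)
  \<comment> \<open>The epigraph over 0 is unbounded above. If \<alpha> were negative, every
    \<open>r\<close> with \<open>r \<ge> (b - 1) / \<alpha>\<close> would give
    \<open>\<alpha> * r \<le> b - 1\<close>.\<close>
  have nonneg: "\<alpha> \<ge> 0"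
  proof (rule ccontr)
    assume "\<not> \<alpha> \<ge> 0"
    then have "\<alpha> < 0" by simp
    then show False
      using above [of 0 "max (p 0) ((b - 1) / \<alpha>)"]
        mult_left_mono_neg [of "(b - 1) / \<alpha>" "max (p 0) ((b - 1) / \<alpha>)" \<alpha>]
      by simp
  qed
  \<comment> \<open>Otherwise the hyperplane is vertical:
    \<open>a \<bullet> e \<ge> b \<ge> 0\<close> for all \<open>e\<close>, and
    \<open>e = - a\<close> forces \<open>a = 0\<close>, hence \<open>z = 0\<close>.\<close>
  have "\<alpha> \<noteq> 0"
  proof
    assume "\<alpha> = 0"
    then have "a \<bullet> (- a) \<ge> 0" using above [of "- a" "p (- a)"] b by simp
    then have "a = 0" using inner_gt_zero_iff [of a] by (simp add: not_less [symmetric])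
    with \<open>\<alpha> = 0\<close> z show False by (simp add: z_eq zero_prod_def)
  qed
  with nonneg have \<alpha>: "\<alpha> > 0" by simp
  show ?thesis
  proof
    \<comment> \<open>The witness is the slope of the separating hyperplane, solved for the vertical
      coordinate.\<close>
    show "(- (1 / \<alpha>) *\<^sub>R a) \<bullet> e \<le> p e" for e
      using above [of e "p e"] b \<alpha> by (simp add: field_simps)
    show "(- (1 / \<alpha>) *\<^sub>R a) \<bullet> J d = v \<bullet> d" for d
      using eq0 [of d] \<alpha> by (simp add: field_simps)
  qed
qed

text \<open>This is strict differentiability: the base point moves along with the step. Continuity
  of the derivative at \<open>x\<close> controls it on the whole segment, and the mean value
  inequality transfers this to the quotient.\<close>

lemma tendsto_difference_quotient_clarke:
  fixes F :: "'a::real_normed_vector \<Rightarrow> 'b::real_normed_vector"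
  assumes F: "\<And>y. (F has_derivative F' y) (at y)" and cont: "isCont (\<lambda>y. F' y d) x"
  shows "((\<lambda>p. (1 / snd p) *\<^sub>R (F (fst p + snd p *\<^sub>R d) - F (fst p))) \<longlongrightarrow> F' x d) (clarke_filter x)"
proof (rule tendstoI)
  fix e :: real assume e: "e > 0"
  then obtain \<delta> where \<delta>: "\<delta> > 0"
    and small: "\<And>y. dist y x < \<delta> \<Longrightarrow> dist (F' y d) (F' x d) < e / 2"
    using cont [unfolded continuous_at_eps_delta] by (meson half_gt_zero)
  have "\<forall>\<^sub>F p in clarke_filter x. dist (fst p) x < \<delta> / 2"
    using \<delta> by (intro tendstoD [OF tendsto_fst_clarke]) simp
  moreover have "((\<lambda>p. snd p * norm d) \<longlongrightarrow> 0) (clarke_filter x)"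
    using tendsto_mult_left_zero [OF tendsto_snd_clarke] .
  then have "\<forall>\<^sub>F p in clarke_filter x. snd p * norm d < \<delta> / 2"
    using \<delta> by (intro order_tendstoD(2)) auto
  ultimately show "\<forall>\<^sub>F p in clarke_filter x.
      dist ((1 / snd p) *\<^sub>R (F (fst p + snd p *\<^sub>R d) - F (fst p))) (F' x d) < e"
    using eventually_snd_pos_clarke
  proof eventually_elim
    case (elim p)
    obtain y t where p: "p = (y, t)" by (cases p)
    have t: "t > 0" using elim by (simp add: p)
    \<comment> \<open>Subtracting the linear term leaves a map whose derivative along the segment is
      at most \<open>e / 2\<close> in norm.\<close>
    define G where "G s = F (y + s *\<^sub>R d) - s *\<^sub>R F' x d" for s
    have "norm (G t - G 0) \<le> e / 2 * norm (t - 0)"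
    proof (rule differentiable_bound)
      show "(G has_derivative (\<lambda>h. h *\<^sub>R (F' (y + s *\<^sub>R d) d - F' x d))) (at s within {0..t})" for s
      proof -
        have "((\<lambda>s. F (y + s *\<^sub>R d)) has_derivative (\<lambda>h. F' (y + s *\<^sub>R d) (h *\<^sub>R d))) (at s within {0..t})"
          by (rule has_derivative_compose [OF _ F]) (auto intro!: derivative_eq_intros)
        then show ?thesis
          unfolding G_def
          by (auto intro!: derivative_eq_intros
              simp: linear_cmul [OF has_derivative_linear [OF F]] scaleR_diff_right)
      qed
      fix s assume s: "s \<in> {0..t}"
      have "dist (y + s *\<^sub>R d) x \<le> dist y x + s * norm d"
        using s norm_triangle_ineq [of "y - x" "s *\<^sub>R d"] by (simp add: dist_norm algebra_simps)
      also have "\<dots> \<le> dist y x + t * norm d"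
        using s by (simp add: mult_right_mono)
      also have "\<dots> < \<delta>" using elim by (simp add: p)
      finally have small': "norm (F' (y + s *\<^sub>R d) d - F' x d) \<le> e / 2"
        using small by (simp add: dist_norm less_imp_le)
      have "norm (h *\<^sub>R (F' (y + s *\<^sub>R d) d - F' x d)) \<le> e / 2 * norm h" for h :: real
        using mult_right_mono [OF small', of "norm h"] by (simp add: mult.commute)
      then show "onorm (\<lambda>h. h *\<^sub>R (F' (y + s *\<^sub>R d) d - F' x d)) \<le> e / 2"
        using e by (intro onorm_bound) simp_all
    qed (use t in auto)
    then have "norm (F (y + t *\<^sub>R d) - F y - t *\<^sub>R F' x d) \<le> e / 2 * t"
      using t by (simp add: G_def algebra_simps)
    moreover have "(1 / t) *\<^sub>R (F (y + t *\<^sub>R d) - F y) - F' x d =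
        (1 / t) *\<^sub>R (F (y + t *\<^sub>R d) - F y - t *\<^sub>R F' x d)"
      using t by (simp add: scaleR_right_diff_distrib)
    then have "norm ((1 / t) *\<^sub>R (F (y + t *\<^sub>R d) - F y) - F' x d) =
        norm (F (y + t *\<^sub>R d) - F y - t *\<^sub>R F' x d) / t"
      using t by simp
    ultimately have "norm ((1 / t) *\<^sub>R (F (y + t *\<^sub>R d) - F y) - F' x d) \<le> e / 2"
      using t by (simp add: pos_divide_le_eq)
    then show ?case using e by (simp add: p dist_norm)
  qed
qed

text \<open>The equality (rather than an inequality) holds because \<open>F\<close>, being open by invariance of
  domain, maps the neighbourhood filter of \<open>x\<close> onto that of \<open>F x\<close>.\<close>

lemma clarke_dderiv_compose:
  fixes F :: "'a::euclidean_space \<Rightarrow> 'a"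
  assumes f: "locally_lipschitz f" and F: "\<And>y. (F has_derivative F' y) (at y)"
    and cont: "isCont (\<lambda>y. F' y d) x" and inj: "inj F"
  shows "clarke_dderiv (f \<circ> F) x d = clarke_dderiv f (F x) (F' x d)"
proof -
  have contF: "isCont F y" for y
    using F has_derivative_continuous by blast
  have "open (F ` S)" if "open S" for S
    using that contF inj
    by (intro invariance_of_domain) (auto intro: continuous_at_imp_continuous_on inj_on_subset)
  then have nhds: "filtermap F (nhds x) = nhds (F x)"
    using contF by (intro filtermap_nhds_open_map)
  let ?D = "F' x d"
  \<comment> \<open>The quotient of \<open>f \<circ> F\<close> splits into
    \<open>u (apfst F p)\<close> and the error \<open>w p\<close> of replacing
    \<open>F (fst p + snd p *\<^sub>R d)\<close> by \<open>F (fst p) + snd p *\<^sub>R ?D\<close>.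
    The Lipschitz bound on \<open>f\<close> makes \<open>w\<close> vanish in the limit.\<close>
  define u where "u p = (f (fst p + snd p *\<^sub>R ?D) - f (fst p)) / snd p" for p
  define w where "w p = (f (F (fst p + snd p *\<^sub>R d)) - f (F (fst p) + snd p *\<^sub>R ?D)) / snd p" for p
  define q where "q p = (1 / snd p) *\<^sub>R (F (fst p + snd p *\<^sub>R d) - F (fst p))" for p
  have q: "(q \<longlongrightarrow> ?D) (clarke_filter x)"
    unfolding q_def by (rule tendsto_difference_quotient_clarke [OF F cont])
  have a: "((\<lambda>p. F (fst p + snd p *\<^sub>R d)) \<longlongrightarrow> F x) (clarke_filter x)"
    by (rule isCont_tendsto_compose [OF contF tendsto_shift_clarke])
  have "((\<lambda>p. F (fst p) + snd p *\<^sub>R ?D) \<longlongrightarrow> F x + 0 *\<^sub>R ?D) (clarke_filter x)"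
    by (intro tendsto_intros isCont_tendsto_compose [OF contF tendsto_fst_clarke] tendsto_snd_clarke)
  then have b: "((\<lambda>p. F (fst p) + snd p *\<^sub>R ?D) \<longlongrightarrow> F x) (clarke_filter x)"
    by simp
  obtain L where L: "\<forall>\<^sub>F p in clarke_filter x.
      \<bar>f (F (fst p + snd p *\<^sub>R d)) - f (F (fst p) + snd p *\<^sub>R ?D)\<bar>
      \<le> L * dist (F (fst p + snd p *\<^sub>R d)) (F (fst p) + snd p *\<^sub>R ?D)"
    using eventually_lipschitz_bound [OF f a b] by blast
  have "(w \<longlongrightarrow> 0) (clarke_filter x)"
  proof (rule Lim_null_comparison)
    have "((\<lambda>p. L * dist (q p) ?D) \<longlongrightarrow> L * dist ?D ?D) (clarke_filter x)"
      by (intro tendsto_intros q)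
    then show "((\<lambda>p. L * dist (q p) ?D) \<longlongrightarrow> 0) (clarke_filter x)"
      by simp
    show "\<forall>\<^sub>F p in clarke_filter x. norm (w p) \<le> L * dist (q p) ?D"
      using L eventually_snd_pos_clarke
    proof eventually_elim
      case (elim p)
      have "q p - ?D = (1 / snd p) *\<^sub>R (F (fst p + snd p *\<^sub>R d) - (F (fst p) + snd p *\<^sub>R ?D))"
        using elim by (simp add: q_def scaleR_diff_right scaleR_add_right)
      then have "dist (q p) ?D = dist (F (fst p + snd p *\<^sub>R d)) (F (fst p) + snd p *\<^sub>R ?D) / snd p"
        using elim by (simp add: dist_norm)
      then show ?case using elim by (simp add: w_def divide_right_mono)
    qed
  qed
  moreover have "clarke_dderiv (f \<circ> F) x d
      = Limsup (clarke_filter x) (\<lambda>p. ereal (u (apfst F p) + w p))"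
    unfolding clarke_dderiv_alt by (simp add: u_def w_def add_divide_distrib [symmetric])
  ultimately have "clarke_dderiv (f \<circ> F) x d = Limsup (clarke_filter x) (\<lambda>p. ereal (u (apfst F p)))"
    using Limsup_ereal_add_tendsto [of "clarke_filter x" w 0 "\<lambda>p. u (apfst F p)"] by simp
  also have "\<dots> = Limsup (filtermap (apfst F) (clarke_filter x)) (\<lambda>p. ereal (u p))"
    using inj by (intro Limsup_filtermap_eq [symmetric]) (auto simp: inj_def)
  also have "\<dots> = clarke_dderiv f (F x) ?D"
    by (simp add: clarke_dderiv_alt u_def nhds flip: prod_filtermap1)
  finally show ?thesis .
qed

text \<open>Equality of the directional derivatives gives the inclusion of the image at once.
  Conversely, a subgradient of \<open>f \<circ> F\<close> is dominated by a convex function composed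
  with \<open>F' x\<close>, so it factors through \<open>F' x\<close> by Hahn--Banach.\<close>

theorem clarke_subdiff_compose:
  fixes F :: "'a::euclidean_space \<Rightarrow> 'a"
  assumes f: "locally_lipschitz f" and F: "\<And>y. (F has_derivative F' y) (at y)"
    and cont: "\<And>d. isCont (\<lambda>y. F' y d) x" and inj: "inj F"
  shows "clarke_subdiff (f \<circ> F) x = adjoint (F' x) ` clarke_subdiff f (F x)"
proof -
  have lin: "linear (F' x)"
    using F by (rule has_derivative_linear)
  have adj: "adjoint (F' x) w \<bullet> d = w \<bullet> F' x d" for w d
    by (rule adjoint_clauses [OF lin])
  have comp: "clarke_dderiv (f \<circ> F) x d = clarke_dderiv f (F x) (F' x d)" for d
    by (rule clarke_dderiv_compose [OF f F cont inj])
  show ?thesis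
  proof (intro equalityI subsetI)
    fix v assume "v \<in> clarke_subdiff (f \<circ> F) x"
    then have v: "ereal (v \<bullet> d) \<le> clarke_dderiv f (F x) (F' x d)" for d
      by (simp add: clarke_subdiff_def comp)
    define p where "p d = real_of_ereal (clarke_dderiv f (F x) d)" for d
    have p: "clarke_dderiv f (F x) d = ereal (p d)" for d
      using clarke_dderiv_finite [OF f, of "F x" d] by (simp add: p_def ereal_real)
    obtain w where "\<And>e. w \<bullet> e \<le> p e" and w: "\<And>d. w \<bullet> F' x d = v \<bullet> d"
      using convex_dominated_factorization [of p "F' x" v] v lin convex_on_clarke_dderiv [OF f, of "F x"]
      by (auto simp: p simp flip: p_def)
    then have "w \<in> clarke_subdiff f (F x)"
      by (simp add: clarke_subdiff_def p)
    moreover have "v = adjoint (F' x) w"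
      using w adj by (metis vector_eq_rdot)
    ultimately show "v \<in> adjoint (F' x) ` clarke_subdiff f (F x)"
      by blast
  next
    fix v assume "v \<in> adjoint (F' x) ` clarke_subdiff f (F x)"
    then show "v \<in> clarke_subdiff (f \<circ> F) x"
      by (auto simp: clarke_subdiff_def comp adj)
  qed
qed

text \<open>The difference quotients of \<open>P\<close> converge, so the upper limit in direction
  \<open>d\<close> merely shifts by \<open>G x \<bullet> d\<close>.\<close>

theorem clarke_subdiff_add_continuously_differentiable:
  fixes g P :: "'a::real_inner \<Rightarrow> real"
  assumes P: "\<And>y. (P has_derivative (\<lambda>d. G y \<bullet> d)) (at y)" and cont: "isCont G x"
  shows "clarke_subdiff (\<lambda>y. g y + P y) x = (\<lambda>v. v + G x) ` clarke_subdiff g x"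
proof -
  have dd: "clarke_dderiv (\<lambda>y. g y + P y) x d = clarke_dderiv g x d + ereal (G x \<bullet> d)" for d
  proof -
    have "((\<lambda>p. (1 / snd p) *\<^sub>R (P (fst p + snd p *\<^sub>R d) - P (fst p))) \<longlongrightarrow> G x \<bullet> d) (clarke_filter x)"
      by (intro tendsto_difference_quotient_clarke P continuous_intros cont)
    from Limsup_ereal_add_tendsto [OF clarke_filter_nontrivial this,
        of "\<lambda>p. (g (fst p + snd p *\<^sub>R d) - g (fst p)) / snd p"]
    show ?thesis
      by (simp add: clarke_dderiv_alt add_divide_distrib [symmetric] add_diff_add)
  qed
  have iff: "v \<in> clarke_subdiff (\<lambda>y. g y + P y) x \<longleftrightarrow> v - G x \<in> clarke_subdiff g x" for v
  proof -
    have "ereal (v \<bullet> d) \<le> c + ereal (G x \<bullet> d) \<longleftrightarrow> ereal ((v - G x) \<bullet> d) \<le> c" for d c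
      by (cases c) (auto simp: inner_diff_left)
    then show ?thesis by (simp add: clarke_subdiff_def dd)
  qed
  show ?thesis
  proof (intro equalityI subsetI)
    fix v assume "v \<in> clarke_subdiff (\<lambda>y. g y + P y) x"
    then show "v \<in> (\<lambda>v. v + G x) ` clarke_subdiff g x"
      by (intro image_eqI [of _ _ "v - G x"]) (simp_all add: iff)
  qed (auto simp: iff)
qed

section \<open>The map \<open>cdA\<close>\<close>

text \<open>With \<open>\<phi> s = 15 s - 10 s\<^sup>3 + 3 s\<^sup>5\<close>, \<open>m = a + b\<close> and \<open>h = a - b\<close>, the difference quotient of
  \<open>\<phi>\<close> is a sum of squares:
  \<open>48 (\<phi> a - \<phi> b) / (a - b) = 5 (12 - 3 m\<^sup>2 - h\<^sup>2)\<^sup>2 + 60 m\<^sup>2 h\<^sup>2 + 4 h\<^sup>4\<close>. Substituting the commuting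
  self-adjoint operators \<open>L\<close>, \<open>R\<close> for \<open>a\<close>, \<open>b\<close> turns strict monotonicity of \<open>\<phi>\<close> into a statement
  on operators.\<close>

lemma odd_quintic_operator_injective:
  fixes L R :: "'a::real_inner \<Rightarrow> 'a"
  assumes L: "linear L" and R: "linear R" and comm: "\<And>x. R (L x) = L (R x)"
    and Ladj: "\<And>x y. L x \<bullet> y = x \<bullet> L y" and Radj: "\<And>x y. R x \<bullet> y = x \<bullet> R y"
    and eq: "15 *\<^sub>R L e - 10 *\<^sub>R L (L (L e)) + 3 *\<^sub>R L (L (L (L (L e)))) =
      15 *\<^sub>R R e - 10 *\<^sub>R R (R (R e)) + 3 *\<^sub>R R (R (R (R (R e))))"
  shows "L e = R e"
proof -
  interpret L: linear L by fact
  interpret R: linear R by fact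
  define m where "m x = L x + R x" for x
  define h where "h x = L x - R x" for x
  define q where "q x = 12 *\<^sub>R x - 3 *\<^sub>R m (m x) - h (h x)" for x
  have m_adj: "m x \<bullet> y = x \<bullet> m y" and h_adj: "h x \<bullet> y = x \<bullet> h y" for x y
    by (simp_all add: m_def h_def inner_add_left inner_add_right inner_diff_left inner_diff_right Ladj Radj)
  have q_adj: "q x \<bullet> y = x \<bullet> q y" for x y
    by (simp add: q_def inner_diff_left inner_diff_right m_adj h_adj)
  note lin = L.add L.diff L.scale R.add R.diff R.scale
  define D where "D = h e"
  \<comment> \<open>The sum-of-squares identity, multiplied by \<open>h\<close> and applied to
    \<open>e\<close>. The factors are ordered so that for \<open>z = D\<close> each term is a
    squared norm by self-adjointness.\<close>
  have "5 * (z \<bullet> q (q D)) + 60 * (z \<bullet> h (m (m (h D)))) + 4 * (z \<bullet> h (h (h (h D)))) =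
      48 * (z \<bullet> (15 *\<^sub>R L e - 10 *\<^sub>R L (L (L e)) + 3 *\<^sub>R L (L (L (L (L e)))))
        - z \<bullet> (15 *\<^sub>R R e - 10 *\<^sub>R R (R (R e)) + 3 *\<^sub>R R (R (R (R (R e))))))" for z
    unfolding D_def q_def m_def h_def by (simp add: lin comm inner_add_right inner_diff_right)
  then have "5 * (D \<bullet> q (q D)) + 60 * (D \<bullet> h (m (m (h D)))) + 4 * (D \<bullet> h (h (h (h D)))) = 0"
    by (simp add: eq)
  then have "5 * (norm (q D))\<^sup>2 + 60 * (norm (m (h D)))\<^sup>2 + 4 * (norm (h (h D)))\<^sup>2 = 0"
    by (simp add: power2_norm_eq_inner q_adj m_adj h_adj)
  then have "(norm (h (h D)))\<^sup>2 = 0"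
    using zero_le_power2 [of "norm (q D)"] zero_le_power2 [of "norm (m (h D))"]
      zero_le_power2 [of "norm (h (h D))"] by linarith
  then have "h (h D) = 0" by simp
  \<comment> \<open>For self-adjoint \<open>h\<close>, \<open>h (h x) = 0\<close> implies
    \<open>h x = 0\<close>; this is used for \<open>x = D\<close> and then for
    \<open>x = e\<close>.\<close>
  then have "h D \<bullet> h D = 0" by (simp add: h_adj)
  then have "h D = 0" by simp
  then have "D \<bullet> D = 0" by (metis D_def h_adj inner_zero_right)
  then show ?thesis by (simp add: D_def h_def)
qed

section \<open>Trace inner product and matrix algebra\<close>

lemma inner_transpose: "transpose X \<bullet> transpose Y = X \<bullet> (Y :: real ^ 'p ^ 'n)"
  unfolding inner_vec_def transpose_def by (simp, rule sum.swap)

lemma inner_matrix_mult_left: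
  fixes A :: "real ^ 'm ^ 'n" and X :: "real ^ 'p ^ 'm"
  shows "(A ** X) \<bullet> Y = X \<bullet> (transpose A ** Y)"
  by (simp add: inner_eq_trace matrix_transpose_mul matrix_mul_assoc)

lemma inner_matrix_mult_right:
  fixes X :: "real ^ 'm ^ 'n" and A :: "real ^ 'p ^ 'm"
  shows "(X ** A) \<bullet> Y = X \<bullet> (Y ** transpose A)"
  using inner_matrix_mult_left [of "transpose A" "transpose X" "transpose Y"]
  by (metis inner_transpose matrix_transpose_mul transpose_transpose)

lemmas matrix_mult_distribs =
  bounded_bilinear.add_left [OF bounded_bilinear_matrix_mult]
  bounded_bilinear.add_right [OF bounded_bilinear_matrix_mult]
  bounded_bilinear.diff_left [OF bounded_bilinear_matrix_mult]
  bounded_bilinear.diff_right [OF bounded_bilinear_matrix_mult]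
  bounded_bilinear.scaleR_left [OF bounded_bilinear_matrix_mult]
  bounded_bilinear.scaleR_right [OF bounded_bilinear_matrix_mult]
  bounded_bilinear.zero_left [OF bounded_bilinear_matrix_mult]
  bounded_bilinear.zero_right [OF bounded_bilinear_matrix_mult]

lemmas transpose_distribs =
  linear_add [OF bounded_linear.linear [OF bounded_linear_transpose]]
  linear_diff [OF bounded_linear.linear [OF bounded_linear_transpose]]
  linear_cmul [OF bounded_linear.linear [OF bounded_linear_transpose]]
  matrix_transpose_mul transpose_transpose transpose_mat

lemma cdA_expand:
  "cdA X = (1 / 8) *\<^sub>R (15 *\<^sub>R X - 10 *\<^sub>R (X ** transpose X ** X)
    + 3 *\<^sub>R (X ** transpose X ** X ** transpose X ** X))"
  by (simp add: cdA_def matrix_mult_distribs matrix_mul_assoc)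

text \<open>Odd powers of the symmetric block matrix with off-diagonal blocks \<open>X\<close> and
  \<open>transpose X\<close> have alternating products of these as their only nonzero blocks. Thus
  \<open>cdA X = cdA Y\<close> and its transpose say that the quintic agrees at the block matrices
  of \<open>X\<close> and \<open>Y\<close>. Left and right multiplications commute, so the operator
  lemma applies without any singular value decomposition.\<close>

lemma inj_cdA: "inj (cdA :: real ^ 'p ^ 'n \<Rightarrow> real ^ 'p ^ 'n)"
proof (rule injI)
  fix X Y :: "real ^ 'p ^ 'n"
  assume A: "cdA X = cdA Y"
  \<comment> \<open>\<open>(P, Q, S, T)\<close> are the blocks of a square matrix of size \<open>n + p\<close>; \<open>L\<close> multiplies it from the
    left by the symmetric matrix with off-diagonal blocks \<open>X\<close> and \<open>X\<^sup>T\<close>, \<open>R\<close> from the right by the one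
    with \<open>Y\<close> and \<open>Y\<^sup>T\<close>, and \<open>e\<close> is the identity.\<close>
  define L :: "(real ^ 'n ^ 'n) \<times> (real ^ 'p ^ 'n) \<times> (real ^ 'n ^ 'p) \<times> (real ^ 'p ^ 'p) \<Rightarrow> _"
    where "L = (\<lambda>(P, Q, S, T). (X ** S, X ** T, transpose X ** P, transpose X ** Q))"
  define R :: "(real ^ 'n ^ 'n) \<times> (real ^ 'p ^ 'n) \<times> (real ^ 'n ^ 'p) \<times> (real ^ 'p ^ 'p) \<Rightarrow> _"
    where "R = (\<lambda>(P, Q, S, T). (Q ** transpose Y, P ** Y, T ** transpose Y, S ** Y))"
  define e :: "(real ^ 'n ^ 'n) \<times> (real ^ 'p ^ 'n) \<times> (real ^ 'n ^ 'p) \<times> (real ^ 'p ^ 'p)"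
    where "e = (mat 1, 0, 0, mat 1)"
  have A': "15 *\<^sub>R X - 10 *\<^sub>R (X ** transpose X ** X)
    + 3 *\<^sub>R (X ** transpose X ** X ** transpose X ** X) =
      15 *\<^sub>R Y - 10 *\<^sub>R (Y ** transpose Y ** Y)
    + 3 *\<^sub>R (Y ** transpose Y ** Y ** transpose Y ** Y)"
    by (rule scaleR_left_imp_eq [OF _ A [unfolded cdA_expand]]) simp
  have A'': "15 *\<^sub>R transpose X - 10 *\<^sub>R (transpose X ** X ** transpose X)
    + 3 *\<^sub>R (transpose X ** X ** transpose X ** X ** transpose X) =
      15 *\<^sub>R transpose Y - 10 *\<^sub>R (transpose Y ** Y ** transpose Y)
    + 3 *\<^sub>R (transpose Y ** Y ** transpose Y ** Y ** transpose Y)"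
    using arg_cong [OF A', of transpose] by (simp only: transpose_distribs matrix_mul_assoc)
  have "L e = R e"
  proof (rule odd_quintic_operator_injective [of L R])
    show "linear L" "linear R"
      by (auto intro!: linearI simp: L_def R_def matrix_mult_distribs)
    show "R (L x) = L (R x)" for x
      by (cases x) (simp add: L_def R_def matrix_mul_assoc)
    show "L x \<bullet> y = x \<bullet> L y" for x y
      by (cases x; cases y) (simp add: L_def inner_matrix_mult_left)
    show "R x \<bullet> y = x \<bullet> R y" for x y
      by (cases x; cases y) (simp add: R_def inner_matrix_mult_right)
    show "15 *\<^sub>R L e - 10 *\<^sub>R L (L (L e)) + 3 *\<^sub>R L (L (L (L (L e)))) =
      15 *\<^sub>R R e - 10 *\<^sub>R R (R (R e)) + 3 *\<^sub>R R (R (R (R (R e))))"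
      using A' A'' by (simp add: L_def R_def e_def matrix_mult_distribs matrix_mul_assoc)
  qed
  then show "X = Y" by (simp add: L_def R_def e_def)
qed

section \<open>The derivative of \<open>cdA\<close>\<close>

lemma jacA_eq:
  fixes X D :: "real ^ 'p ^ 'n"
  shows "jacA X D = (1 / 8) *\<^sub>R (15 *\<^sub>R D
    - 10 *\<^sub>R (D ** transpose X ** X + X ** transpose D ** X + X ** transpose X ** D)
    + 3 *\<^sub>R (D ** transpose X ** X ** transpose X ** X + X ** transpose D ** X ** transpose X ** X
      + X ** transpose X ** D ** transpose X ** X + X ** transpose X ** X ** transpose D ** X
      + X ** transpose X ** X ** transpose X ** D))" (is "_ = ?J D")
proof -
  note mult = bounded_bilinear.FDERIV [OF bounded_bilinear_matrix_mult]
  have T: "(transpose has_derivative transpose) (at X)"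
    by (rule bounded_linear_imp_has_derivative [OF bounded_linear_transpose])
  note cubic = mult [OF mult [OF has_derivative_ident T] has_derivative_ident]
  note quintic = mult [OF mult [OF cubic T] has_derivative_ident]
  have "(cdA has_derivative ?J) (at X)"
    unfolding cdA_expand [abs_def]
    by (rule has_derivative_eq_rhs, rule has_derivative_scaleR_right [OF has_derivative_add
          [OF has_derivative_diff [OF has_derivative_scaleR_right [OF has_derivative_ident]
              has_derivative_scaleR_right [OF cubic]] has_derivative_scaleR_right [OF quintic]]])
      (simp add: fun_eq_iff matrix_mult_distribs matrix_mul_assoc ac_simps)
  from has_derivative_unique [OF has_derivative_cdA this] show ?thesis
    by (rule fun_cong)
qed

lemma isCont_jacA: "isCont (\<lambda>X. jacA X D) X"
  unfolding jacA_eq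
  by (intro continuous_intros bounded_bilinear.continuous [OF bounded_bilinear_matrix_mult]
      bounded_linear.continuous [OF bounded_linear_transpose])

text \<open>Monomials in \<open>D\<close> have symmetric outer factors and are self-adjoint
  (\<open>sandwich\<close>). Passing to the adjoint exchanges the outer factors of monomials in
  \<open>transpose D\<close> (\<open>flip\<close>): the cubic one is fixed and the two quintic ones
  are swapped.\<close>

lemma adjoint_jacA:
  fixes X :: "real ^ 'p ^ 'n"
  shows "adjoint (jacA X) = jacA X"
proof (rule adjoint_unique, intro allI)
  fix D E :: "real ^ 'p ^ 'n"
  have sandwich: "(A ** D ** B) \<bullet> E = D \<bullet> (transpose A ** E ** transpose B)"
    for A :: "real ^ 'n ^ 'n" and B :: "real ^ 'p ^ 'p"
    by (simp only: inner_matrix_mult_right [of _ B] inner_matrix_mult_left [of A] matrix_mul_assoc)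
  have flip: "(A ** transpose D ** B) \<bullet> E = D \<bullet> (B ** transpose E ** A)" for A B :: "real ^ 'p ^ 'n"
  proof -
    have "(A ** transpose D ** B) \<bullet> E = transpose D \<bullet> (transpose A ** E ** transpose B)"
      by (simp only: inner_matrix_mult_right [of _ B] inner_matrix_mult_left [of A] matrix_mul_assoc)
    also have "\<dots> = D \<bullet> transpose (transpose A ** E ** transpose B)"
      by (metis inner_transpose transpose_transpose)
    finally show ?thesis by (simp add: transpose_distribs matrix_mul_assoc)
  qed
  let ?M = "transpose X ** X" and ?N = "X ** transpose X"
  show "jacA X D \<bullet> E = D \<bullet> jacA X E"
    using flip [of X X] flip [of X "X ** ?M"] flip [of "X ** ?M" X]
      sandwich [of "mat 1" ?M] sandwich [of "mat 1" "?M ** ?M"] sandwich [of ?N ?M]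
      sandwich [of ?N "mat 1"] sandwich [of "?N ** ?N" "mat 1"]
    by (simp add: jacA_eq inner_add_left inner_add_right inner_diff_left inner_diff_right
        matrix_mul_assoc transpose_distribs)
qed

section \<open>The penalty term\<close>

text \<open>Differentiating \<open>M \<bullet> M\<close> produces
  \<open>M \<bullet> (transpose X ** D)\<close> and \<open>M \<bullet> (transpose D ** X)\<close>,
  each twice. As \<open>M\<close> is symmetric, all four equal \<open>(X ** M) \<bullet> D\<close>,
  which cancels the 4.\<close>

lemma has_derivative_penalty:
  fixes X :: "real ^ 'p ^ 'n"
  shows "((\<lambda>X. \<beta> / 4 * (norm (transpose X ** X - mat 1))\<^sup>2) has_derivative
    (\<lambda>D. (\<beta> *\<^sub>R (X ** (transpose X ** X - mat 1))) \<bullet> D)) (at X)"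
proof -
  note [derivative_intros] = bounded_bilinear.FDERIV [OF bounded_bilinear_matrix_mult]
    bounded_linear.has_derivative [OF bounded_linear_transpose]
  define M where "M = transpose X ** X - mat 1"
  have M: "transpose M = M" by (simp add: M_def transpose_distribs)
  have 1: "M \<bullet> (transpose X ** D) = (X ** M) \<bullet> D" for D
    by (simp add: inner_matrix_mult_left)
  have "M \<bullet> (transpose D ** X) = transpose M \<bullet> transpose (transpose D ** X)" for D
    by (simp only: inner_transpose)
  then have 2: "M \<bullet> (transpose D ** X) = (X ** M) \<bullet> D" for D
    by (simp add: M transpose_distribs 1)
  show ?thesis
    unfolding power2_norm_eq_inner
    by (rule derivative_eq_intros refl)+
      (simp add: fun_eq_iff 1 2 inner_commute inner_add_right flip: M_def)
qed

lemma isCont_penalty_gradient: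
  fixes X :: "real ^ 'p ^ 'n"
  shows "isCont (\<lambda>X. \<beta> *\<^sub>R (X ** (transpose X ** X - mat 1))) X"
  by (intro continuous_intros bounded_bilinear.continuous [OF bounded_bilinear_matrix_mult]
      bounded_linear.continuous [OF bounded_linear_transpose])

section \<open>The two subdifferential formulas\<close>

theorem proposition3p6:
  fixes f :: "real ^ 'p ^ 'n \<Rightarrow> real" and \<beta> :: real and X :: "real ^ 'p ^ 'n"
  assumes "locally_lipschitz f" and "\<beta> > 0"
  shows "clarke_subdiff (f \<circ> cdA) X = jacA X ` clarke_subdiff f (cdA X)
    \<and> clarke_subdiff (cdh f \<beta>) X =
      (\<lambda>V. V + \<beta> *\<^sub>R (X ** (transpose X ** X - mat 1))) ` (jacA X ` clarke_subdiff f (cdA X))"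
proof -
  have g: "clarke_subdiff (f \<circ> cdA) X = jacA X ` clarke_subdiff f (cdA X)"
    using clarke_subdiff_compose [OF assms(1) has_derivative_cdA isCont_jacA inj_cdA]
    by (simp add: adjoint_jacA)
  have "cdh f \<beta> = (\<lambda>Y. (f \<circ> cdA) Y + \<beta> / 4 * (norm (transpose Y ** Y - mat 1))\<^sup>2)"
    by (simp add: cdh_def fun_eq_iff)
  then have "clarke_subdiff (cdh f \<beta>) X =
      (\<lambda>V. V + \<beta> *\<^sub>R (X ** (transpose X ** X - mat 1))) ` clarke_subdiff (f \<circ> cdA) X"
    by (simp only: clarke_subdiff_add_continuously_differentiable
        [OF has_derivative_penalty isCont_penalty_gradient])
  with g show ?thesis by simp
qed

end
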